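(* Let $G^\sigma$ be a signed cycle of order $n\ge 3$, so that its girth $g=g(G^\sigma)$ equals $n$, and let $\lambda\in\mathbb{R}$. Then \[ m(G^\sigma,\lambda)=n-g(G^\sigma)+2 \] if and only if one of the following holds: (i) $G^\sigma$ is a balanced cycle and $\lambda=2\cos\left(\frac{2\pi j}{g}\right)$ for some $j\in\left\{1,2,\dots,\left\lceil\frac{g}{2}\right\rceil-1\right\}$; (ii) $G^\sigma$ is an unbalanced cycle and $\lambda=2\cos\left(\frac{(2j+1)\pi}{g}\right)$ for some $j\in\left\{0,1,\dots,\left\lceil\frac{g-1}{2}\right\rceil-1\right\}$.
   Context: A signed graph $G^\sigma=(G,\sigma)$ consists of a finite simple undirected graph $G=(V,E)$ and a sign function $\sigma:E\to\{+1,-1\}$; its order is $n=|V|$ and its girth $g(G^\sigma)$ is the length of a shortest cycle of $G$. A signed cycle of order $n$ is a signed graph whose underlying graph is the cycle $C_n$; it is balanced if the product of the signs of its edges is $+1$, and unbalanced otherwise. The adjacency matrix $A(G^\sigma)=[a^\sigma_{ij}]$ has $a^\sigma_{ij}=\sigma(v_iv_j)$ if $v_i$ and $v_j$ are adjacent and $a^\sigma_{ij}=0$ otherwise. $m(G^\sigma,\lambda)=n-\operatorname{rank}(\lambda I-A(G^\sigma))$ denotes the multiplicity of $\lambda$ as an eigenvalue of $A(G^\sigma)$ (equal to $0$ if $\lambda$ is not an eigenvalue). *)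

theory Defs
  imports "HOL-Analysis.Analysis"
begin

text \<open>
  A signed graph has the elements of a finite type as its vertices, a set of two-element vertex
  sets as its edges, and a sign function whose values outside the edge set are irrelevant.
\<close>

definition signed_graph :: "'v::finite set set \<Rightarrow> ('v set \<Rightarrow> int) \<Rightarrow> bool" where
  "signed_graph E \<sigma> \<longleftrightarrow> (\<forall>e\<in>E. card e = 2) \<and> (\<forall>e\<in>E. \<sigma> e \<in> {1, -1})"

definition closed_walk_edges :: "'v list \<Rightarrow> 'v set set" where
  "closed_walk_edges vs = {{vs ! i, vs ! (Suc i mod length vs)} | i. i < length vs}"

definition cycle_in :: "'v set set \<Rightarrow> 'v list \<Rightarrow> bool" where
  "cycle_in E vs \<longleftrightarrow> 3 \<le> length vs \<and> distinct vs \<and> closed_walk_edges vs \<subseteq> E"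

text \<open>The girth is unspecified if there is no cycle.\<close>

definition girth :: "'v set set \<Rightarrow> nat" where
  "girth E = (LEAST k. \<exists>vs. cycle_in E vs \<and> length vs = k)"

definition signed_cycle :: "'v::finite set set \<Rightarrow> ('v set \<Rightarrow> int) \<Rightarrow> bool" where
  "signed_cycle E \<sigma> \<longleftrightarrow> signed_graph E \<sigma> \<and>
     (\<exists>vs. cycle_in E vs \<and> set vs = UNIV \<and> E = closed_walk_edges vs)"

definition balanced_cycle :: "'v::finite set set \<Rightarrow> ('v set \<Rightarrow> int) \<Rightarrow> bool" where
  "balanced_cycle E \<sigma> \<longleftrightarrow> signed_cycle E \<sigma> \<and> (\<Prod>e\<in>E. \<sigma> e) = 1"

definition unbalanced_cycle :: "'v::finite set set \<Rightarrow> ('v set \<Rightarrow> int) \<Rightarrow> bool" where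
  "unbalanced_cycle E \<sigma> \<longleftrightarrow> signed_cycle E \<sigma> \<and> (\<Prod>e\<in>E. \<sigma> e) \<noteq> 1"

definition adjacency_matrix :: "'v::finite set set \<Rightarrow> ('v set \<Rightarrow> int) \<Rightarrow> real ^ 'v ^ 'v" where
  "adjacency_matrix E \<sigma> = (\<chi> u v. if {u, v} \<in> E then real_of_int (\<sigma> {u, v}) else 0)"

definition eigenvalue_mult :: "'v::finite set set \<Rightarrow> ('v set \<Rightarrow> int) \<Rightarrow> real \<Rightarrow> nat" where
  "eigenvalue_mult E \<sigma> lam =
     CARD('v) - rank (lam *\<^sub>R (mat 1 :: real ^ 'v ^ 'v) - adjacency_matrix E \<sigma>)"

end

theory Submission
  imports Defs
begin

text \<open>
  Enumerate the vertices cyclically as $v_0, v_1, \dots$ and let $p_i$ be the product of the signs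
  of the first $i$ edges. If $x$ is an eigenvector for $\lambda$, then $z_i = p_i x(v_i)$ satisfies
  $z_{i+2} = \lambda z_{i+1} - z_i$ and $z_{i+n} = P z_i$, where $P$ is the sign of the cycle.
  Hence $x \mapsto (x(v_0), x(v_1))$ embeds the eigenspace into the plane, and the multiplicity is
  $2$ iff every solution of the recurrence satisfies $z_{i+n} = P z_i$, i.e. iff the solution
  $U$ with $U_0 = 0$, $U_1 = 1$ has $U_n = 0$ and $U_{n+1} = P$. For $|\lambda| \ge 2$ the sequence
  $|U_i|$ is strictly increasing; for $\lambda = 2\cos t$ with $0 < t < \pi$ one has
  $U_i = \sin(it)/\sin t$, so that $t = k\pi/n$ with $0 < k < n$ and $P = (-1)^k$.
\<close>


section \<open>Linear algebra: the kernel of a matrix\<close>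

text \<open>The kernel is the orthogonal complement of the row space, and the rank is the dimension
  of the row space. This turns the rank in \<open>eigenvalue_mult\<close> into the dimension of an
  eigenspace.\<close>

lemma dim_kernel_matrix:
  fixes M :: "real ^ 'n ^ 'm"
  shows "dim {x. M *v x = 0} + rank M = CARD('n)"
proof -
  have "(\<forall>y\<in>span (rows M). orthogonal y x) \<longleftrightarrow> M *v x = 0" for x
  proof
    assume *: "\<forall>y\<in>span (rows M). orthogonal y x"
    have "(M *v x) $ i = 0" for i
    proof -
      have "row i M \<in> span (rows M)"
        by (intro span_base) (auto simp: rows_def)
      with * have "row i M \<bullet> x = 0" by (simp only: orthogonal_def)
      then show ?thesis by (simp only: matrix_vector_mul_component row_def vec_nth_inverse)
    qed
    then show "M *v x = 0" by (simp add: vec_eq_iff)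
  next
    assume "M *v x = 0"
    then show "\<forall>y\<in>span (rows M). orthogonal y x"
      using orthogonal_nullspace_rowspace orthogonal_commute by blast
  qed
  then have eq: "{x \<in> UNIV. \<forall>y\<in>span (rows M). orthogonal y x} = {x. M *v x = 0}"
    by simp
  have "dim {x \<in> UNIV. \<forall>y\<in>span (rows M). orthogonal y x} + dim (span (rows M))
      = dim (UNIV :: (real ^ 'n) set)"
    by (intro dim_subspace_orthogonal_to_vectors) auto
  then show ?thesis
    unfolding eq by (simp add: row_rank_def)
qed

lemma shifted_matrix_mult:
  fixes x :: "real ^ 'v" and B :: "real ^ 'v ^ 'v"
  shows "(l *\<^sub>R mat 1 - B) *v x = l *\<^sub>R x - B *v x"
proof -
  have 1: "(l *\<^sub>R mat 1 - B) *v x = (l *\<^sub>R mat 1) *v x - B *v x"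
    by (rule matrix_vector_mult_diff_rdistrib)
  have 2: "(l *\<^sub>R (mat 1 :: real ^ 'v ^ 'v)) *v x = l *\<^sub>R (mat 1 *v x)"
    by (rule scaleR_matrix_vector_assoc[symmetric])
  show ?thesis unfolding 1 2 matrix_vector_mul_lid ..
qed

section \<open>The three-term recurrence and its quasi-periodic solutions\<close>

text \<open>For starting values 0 and 1, the value at \<open>Suc i\<close> is the Chebyshev
  polynomial of the second kind of degree \<open>i\<close>, evaluated at
  \<open>l / 2\<close>.\<close>

fun rec2 :: "real \<Rightarrow> real \<Rightarrow> real \<Rightarrow> nat \<Rightarrow> real" where
  "rec2 l a b 0 = a"
| "rec2 l a b (Suc 0) = b"
| "rec2 l a b (Suc (Suc i)) = l * rec2 l a b (Suc i) - rec2 l a b i"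

lemma rec2_unique:
  assumes "\<And>i. z (Suc (Suc i)) = l * z (Suc i) - z i"
  shows "z i = rec2 l (z 0) (z 1) i"
  by (induction i rule: induct_nat_012) (auto simp: assms)

text \<open>The recurrence is linear and invariant under shifts, so both sides solve it and only the
  first two indices need comparing. Index 0 is left out because it would need the value -1 of the
  fundamental solution at index -1.\<close>

lemma rec2_fundamental: "rec2 l a b (Suc i) = b * rec2 l 0 1 (Suc i) - a * rec2 l 0 1 i"
proof (induction i rule: induct_nat_012)
  case (ge2 i)
  have "rec2 l a b (Suc (Suc (Suc i))) = l * rec2 l a b (Suc (Suc i)) - rec2 l a b (Suc i)" by simp
  then show ?case unfolding ge2 by (simp add: algebra_simps)
qed auto

text \<open>The shift by \<open>n\<close> of a solution is again a solution, so it suffices to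
  compare it with the multiple by \<open>P\<close> at two consecutive indices. For the fundamental
  solution these are 0 and 1; every other solution is a combination of it and its shift.\<close>

lemma rec2_all_quasiperiodic_iff:
  "(\<forall>a b i. rec2 l a b (i + n) = P * rec2 l a b i) \<longleftrightarrow> rec2 l 0 1 n = 0 \<and> rec2 l 0 1 (Suc n) = P"
proof safe
  assume *: "\<forall>a b i. rec2 l a b (i + n) = P * rec2 l a b i"
  show "rec2 l 0 1 n = 0" using *[rule_format, of 0 1 0] by simp
  show "rec2 l 0 1 (Suc n) = P" using *[rule_format, of 0 1 1] by simp
next
  fix a b i
  assume U: "rec2 l 0 1 n = 0" "P = rec2 l 0 1 (Suc n)"
  have fund: "rec2 l 0 1 (j + n) = rec2 l 0 1 (Suc n) * rec2 l 0 1 j" for j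
    by (induction j rule: induct_nat_012) (auto simp: U algebra_simps)
  have shift: "rec2 l a b (Suc j + n) = P * rec2 l a b (Suc j)" for j
    using fund[of j] fund[of "Suc j"] unfolding U(2)
    by (simp add: rec2_fundamental[of l a b] algebra_simps)
  show "rec2 l a b (i + n) = rec2 l 0 1 (Suc n) * rec2 l a b i"
  proof (cases i)
    case 0
    \<comment> \<open>Index 0 is out of reach of \<open>rec2_fundamental\<close>; it follows from
      indices 1 and 2 by running the recurrence backwards.\<close>
    have "rec2 l a b (Suc (Suc n)) = l * rec2 l a b (Suc n) - rec2 l a b n" by simp
    then show ?thesis using shift[of 0] shift[of 1] 0 U by (simp add: algebra_simps)
  next
    case (Suc j)
    then show ?thesis using shift[of j] U by simp
  qed
qed

text \<open>By the addition formulas, sin(it) satisfies the recurrence with coefficient 2 cos t. The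
  product form avoids assuming that sin t is nonzero.\<close>

lemma rec2_sin: "rec2 (2 * cos t) 0 1 i * sin t = sin (real i * t)"
proof (induction i rule: induct_nat_012)
  case (ge2 i)
  have "sin (real (Suc (Suc i)) * t) + sin (real i * t) = 2 * cos t * sin (real (Suc i) * t)"
    using sin_add[of "real (Suc i) * t" t] sin_diff[of "real (Suc i) * t" t]
    by (simp add: algebra_simps)
  then show ?case using ge2 by (simp add: algebra_simps)
qed auto

text \<open>The reverse triangle inequality bounds the next absolute value below by twice the
  current one minus the previous one, which exceeds the current one by induction.\<close>

lemma abs_rec2_less:
  assumes "\<bar>l\<bar> \<ge> 2"
  shows "\<bar>rec2 l 0 1 (Suc i)\<bar> > \<bar>rec2 l 0 1 i\<bar>"
proof (induction i)
  case (Suc i)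
  have "2 * \<bar>rec2 l 0 1 (Suc i)\<bar> \<le> \<bar>l * rec2 l 0 1 (Suc i)\<bar>"
    unfolding abs_mult using assms by (intro mult_right_mono) auto
  then show ?case using Suc by simp
qed auto

lemma rec2_fundamental_quasiperiodic_iff:
  assumes n: "n > 0"
  shows "rec2 l 0 1 n = 0 \<and> rec2 l 0 1 (Suc n) = P \<longleftrightarrow>
    (\<exists>k. 0 < k \<and> k < n \<and> l = 2 * cos (real k * pi / real n) \<and> P = (- 1) ^ k)"
proof
  assume U: "rec2 l 0 1 n = 0 \<and> rec2 l 0 1 (Suc n) = P"
  have "\<bar>l\<bar> < 2"
  proof (rule ccontr)
    assume "\<not> \<bar>l\<bar> < 2"
    then have "\<bar>rec2 l 0 1 (Suc (n - 1))\<bar> > 0"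
      using abs_rec2_less[of l "n - 1"] by linarith
    with U n show False by simp
  qed
  then have l: "-1 < l / 2" "l / 2 < 1" by auto
  \<comment> \<open>The strict bounds on \<open>l / 2\<close> put \<open>t\<close> strictly between
    0 and pi, so that sin t can be cancelled below.\<close>
  define t where "t = arccos (l / 2)"
  have t: "0 < t" "t < pi" and lt: "l = 2 * cos t"
    using arccos_lt_bounded[OF l] l unfolding t_def by (auto simp: cos_arccos)
  have st: "sin t > 0" using t by (rule sin_gt_zero)
  have "sin (real n * t) = 0" using rec2_sin[of t n] U lt by simp
  then obtain m :: int where m: "real n * t = of_int m * pi"
    using sin_zero_iff_int2 by blast
  \<comment> \<open>The bounds on \<open>t\<close>, multiplied by \<open>n\<close>, become the
    bounds 0 < \<open>m\<close> < \<open>n\<close>.\<close>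
  have "0 < of_int m * pi" unfolding m[symmetric] using n t by simp
  then have m0: "m > 0" by (simp add: zero_less_mult_iff)
  have "of_int m * pi < real n * pi" unfolding m[symmetric] using n t by simp
  then have mn: "m < int n" by simp
  define k where "k = nat m"
  have mk: "m = int k" using m0 k_def by simp
  have tk: "real n * t = real k * pi" using m mk by simp
  have "rec2 l 0 1 (Suc n) * sin t = sin (real n * t + t)"
    using rec2_sin[of t "Suc n"] lt by (simp add: algebra_simps)
  also have "\<dots> = (- 1) ^ k * sin t"
    unfolding sin_add tk by simp
  finally have "P = (- 1) ^ k" using U st by simp
  moreover have "t = real k * pi / real n" using tk n by (simp add: field_simps)
  ultimately show "\<exists>k. 0 < k \<and> k < n \<and> l = 2 * cos (real k * pi / real n) \<and> P = (- 1) ^ k"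
    using m0 mn mk lt by auto
next
  assume "\<exists>k. 0 < k \<and> k < n \<and> l = 2 * cos (real k * pi / real n) \<and> P = (- 1) ^ k"
  then obtain k where k: "0 < k" "k < n" "l = 2 * cos (real k * pi / real n)" "P = (- 1) ^ k"
    by blast
  define t where "t = real k * pi / real n"
  have tk: "real n * t = real k * pi" using n by (simp add: t_def)
  have "0 < t" "t < pi" using k n by (auto simp: t_def field_simps)
  then have st: "sin t > 0" by (rule sin_gt_zero)
  have l: "l = 2 * cos t" using k t_def by simp
  have "rec2 l 0 1 n * sin t = 0" using rec2_sin[of t n] l tk by simp
  moreover have "rec2 l 0 1 (Suc n) * sin t = sin (real n * t + t)"
    using rec2_sin[of t "Suc n"] l by (simp add: algebra_simps)
  then have "rec2 l 0 1 (Suc n) * sin t = P * sin t"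
    unfolding sin_add tk k(4) by simp
  ultimately show "rec2 l 0 1 n = 0 \<and> rec2 l 0 1 (Suc n) = P"
    using st by simp
qed


section \<open>Cyclic enumeration of the vertices and the girth\<close>

text \<open>The enumeration is a periodic sequence on all naturals, so that the successor of a
  vertex is always reached by \<open>Suc\<close>, without wrapping around.\<close>

locale cycle_enumeration =
  fixes v :: "nat \<Rightarrow> 'v::finite" and E :: "'v set set" and \<sigma> :: "'v set \<Rightarrow> int" and n :: nat
  assumes n3: "3 \<le> n"
    and v_eq_iff: "v i = v j \<longleftrightarrow> i mod n = j mod n"
    and v_surj: "range v = UNIV"
    and edges: "E = range (\<lambda>i. {v i, v (Suc i)})"
    and signs: "e \<in> E \<Longrightarrow> \<sigma> e \<in> {1, -1}"
begin

lemma v_add: "v (i + n) = v i"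
  by (simp add: v_eq_iff)

lemma v_mod: "v (i mod n) = v i"
  by (simp add: v_eq_iff)

lemma inj_on_v: "inj_on v {..<n}"
  by (auto simp: inj_on_def v_eq_iff)

lemma v_image: "v ` {..<n} = UNIV"
proof -
  have "w \<in> v ` {..<n}" for w
  proof -
    obtain i where "w = v i" using v_surj by blast
    then have "w = v (i mod n)" "i mod n < n" using n3 by (auto simp: v_mod)
    then show ?thesis by blast
  qed
  then show ?thesis by blast
qed

lemma card_vertices: "CARD('v) = n"
  using card_image[OF inj_on_v] v_image by simp

text \<open>Adding the period makes every index a successor. Neighbourhoods can thus be described at
  \<open>v (Suc i)\<close> without subtraction.\<close>

lemma obtain_Suc:
  obtains i where "w = v (Suc i)"
proof -
  obtain i where "w = v i" using v_surj by blast
  then have "w = v (Suc (i + n - 1))" using n3 v_add[of i] by simp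
  then show ?thesis using that by blast
qed

lemma v_Suc_eq_iff: "v (Suc i) = v (Suc j) \<longleftrightarrow> v i = v j"
  by (auto simp: v_eq_iff mod_Suc)

lemma v_neq_Suc_Suc: "v i \<noteq> v (Suc (Suc i))"
  using n3 by (auto simp: v_eq_iff mod_Suc split: if_splits)

lemma edge: "{v i, v (Suc i)} \<in> E"
  unfolding edges by blast

lemma edge_Suc_iff: "{v (Suc i), w} \<in> E \<longleftrightarrow> w = v i \<or> w = v (Suc (Suc i))"
proof
  assume "{v (Suc i), w} \<in> E"
  then obtain j where j: "{v (Suc i), w} = {v j, v (Suc j)}" unfolding edges by blast
  then consider "v (Suc i) = v j" "w = v (Suc j)" | "v (Suc i) = v (Suc j)" "w = v j"
    by (auto simp: doubleton_eq_iff)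
  then show "w = v i \<or> w = v (Suc (Suc i))"
    by cases (metis v_Suc_eq_iff)+
next
  assume "w = v i \<or> w = v (Suc (Suc i))"
  then show "{v (Suc i), w} \<in> E" using edge[of i] edge[of "Suc i"] by (auto simp: insert_commute)
qed

text \<open>The vertex set of \<open>ws\<close> is nonempty and closed under passing to the next
  vertex of the enumeration, hence contains every vertex; as \<open>ws\<close> is distinct, its
  length is the number of vertices.\<close>

lemma cycle_in_length:
  assumes "cycle_in E ws"
  shows "length ws = n"
proof -
  define k where "k = length ws"
  have k3: "3 \<le> k" and dist: "distinct ws" and sub: "closed_walk_edges ws \<subseteq> E"
    using assms by (auto simp: cycle_in_def k_def)
  have ed: "{ws ! i, ws ! (Suc i mod k)} \<in> E" if "i < k" for i
    using sub that unfolding closed_walk_edges_def k_def by blast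
  \<comment> \<open>A vertex of the cycle \<open>ws\<close> has two distinct neighbours on it, but only two in the whole graph.\<close>
  have step: "v (Suc (Suc i)) \<in> set ws" if mem: "v (Suc i) \<in> set ws" for i
  proof -
    obtain m where m: "m < k" "v (Suc i) = ws ! m"
      using mem by (auto simp: in_set_conv_nth k_def)
    define a where "a = Suc m mod k"
    \<comment> \<open>The predecessor of \<open>m\<close> modulo \<open>k\<close>; adding
      \<open>k\<close> first keeps the natural subtraction from truncating.\<close>
    define b where "b = (m + k - 1) mod k"
    have ab: "a < k" "b < k" using k3 by (auto simp: a_def b_def)
    have bm: "Suc b mod k = m" using k3 m(1) by (simp add: b_def mod_Suc_eq)
    have "a \<noteq> b"
    proof
      assume "a = b"
      then have "Suc (Suc m mod k) mod k = m" using bm by (simp add: a_def)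
      then have "Suc (Suc m) mod k = m" by (simp only: mod_Suc_eq)
      then show False using m k3 by (auto simp: mod_Suc split: if_splits)
    qed
    then have neq: "ws ! a \<noteq> ws ! b"
      using ab dist by (simp add: nth_eq_iff_index_eq k_def)
    have "{v (Suc i), ws ! a} \<in> E" using ed[OF m(1)] m by (simp add: a_def)
    moreover have "{v (Suc i), ws ! b} \<in> E"
      using ed[OF ab(2)] m bm by (simp add: insert_commute)
    ultimately have "v (Suc (Suc i)) = ws ! a \<or> v (Suc (Suc i)) = ws ! b"
      using neq by (auto simp: edge_Suc_iff)
    then show ?thesis using ab by (auto simp: k_def)
  qed
  obtain i where i: "hd ws = v (Suc i)" by (rule obtain_Suc)
  have "ws \<noteq> []" using k3 by (auto simp: k_def)
  then have base: "v (Suc i) \<in> set ws" using i hd_in_set by metis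
  have all: "v (Suc (i + j)) \<in> set ws" for j
    by (induction j) (use base step in auto)
  have "w \<in> set ws" for w
  proof -
    obtain j where j: "w = v j" using v_surj by blast
    \<comment> \<open>Enough full turns are added to \<open>j\<close> to bring it past the starting
      index \<open>Suc i\<close>.\<close>
    have "Suc i \<le> j + Suc i * n" using n3 mult_le_mono2[of 1 n "Suc i"] by simp
    then obtain d where "j + Suc i * n = Suc (i + d)" by (metis le_Suc_ex add_Suc)
    moreover have "v (j + Suc i * n) = v j" unfolding v_eq_iff by (rule mod_mult_self1)
    ultimately show ?thesis using all[of d] j by metis
  qed
  then have "set ws = UNIV" by blast
  then show ?thesis using distinct_card[OF dist] card_vertices by simp
qed

lemma girth_eq:
  assumes "cycle_in E ws"
  shows "girth E = n"
  unfolding girth_def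
  by (rule Least_equality) (use assms cycle_in_length in auto)

section \<open>Edge signs and the switching function\<close>

definition edge_sign :: "nat \<Rightarrow> real" where
  "edge_sign i = of_int (\<sigma> {v i, v (Suc i)})"

text \<open>This is a switching function along the path from \<open>v 0\<close>. It lives on indices
  rather than vertices, since each full turn multiplies it by the sign of the cycle.\<close>

definition switch :: "nat \<Rightarrow> real" where
  "switch i = (\<Prod>k<i. edge_sign k)"

lemma edge_sign_square: "edge_sign i * edge_sign i = 1"
  using signs[OF edge[of i]] by (auto simp: edge_sign_def)

lemma edge_sign_cancel: "edge_sign i * (edge_sign i * c) = c"
  by (simp only: mult.assoc[symmetric] edge_sign_square mult_1)

lemma switch_Suc: "switch (Suc i) = edge_sign i * switch i"
  by (simp add: switch_def)

lemma switch_square: "switch i * switch i = 1"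
proof (induction i)
  case (Suc i)
  have "switch (Suc i) * switch (Suc i) = (edge_sign i * edge_sign i) * (switch i * switch i)"
    by (simp add: switch_Suc ac_simps)
  then show ?case by (simp only: Suc edge_sign_square mult_1)
qed (simp add: switch_def)

lemma edge_sign_add: "edge_sign (i + n) = edge_sign i"
  using v_add[of i] v_add[of "Suc i"] by (simp add: edge_sign_def)

lemma switch_add: "switch (i + n) = switch n * switch i"
  by (induction i) (auto simp: switch_Suc edge_sign_add switch_def)

text \<open>The first \<open>n\<close> consecutive pairs run through every edge exactly once, so the
  product over indices is the product over edges.\<close>

lemma switch_n: "switch n = of_int (\<Prod>e\<in>E. \<sigma> e)"
proof -
  let ?e = "\<lambda>i. {v i, v (Suc i)}"
  have "inj_on ?e {..<n}"
  proof
    fix i j assume ij: "i \<in> {..<n}" "j \<in> {..<n}" and eq: "?e i = ?e j"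
    then consider "v i = v j" | "v i = v (Suc j)" "v (Suc i) = v j"
      by (auto simp: doubleton_eq_iff)
    then show "i = j"
    proof cases
      case 1 then show ?thesis using ij inj_on_v by (auto dest: inj_onD)
    next
      \<comment> \<open>Two pairs matched in reverse would give a vertex the same predecessor and
        successor, which is impossible for \<open>n\<close> at least 3.\<close>
      case 2
      then have "v (Suc (Suc j)) = v j" using v_Suc_eq_iff by metis
      then show ?thesis using v_neq_Suc_Suc[of j] by simp
    qed
  qed
  moreover have "?e ` {..<n} = E"
  proof -
    have "?e i = ?e (i mod n)" for i
      using v_mod[of i] v_Suc_eq_iff[of i "i mod n"] by simp
    moreover have "i mod n < n" for i using n3 by simp
    ultimately have "?e i \<in> ?e ` {..<n}" for i by blast
    then show ?thesis unfolding edges by blast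
  qed
  ultimately have "prod \<sigma> E = (\<Prod>i<n. \<sigma> (?e i))"
    using prod.reindex[of ?e "{..<n}" \<sigma>] by simp
  then show ?thesis by (simp add: switch_def edge_sign_def)
qed

section \<open>The eigenspace and its dimension\<close>

lemma adjacency_mult_Suc:
  "(adjacency_matrix E \<sigma> *v x) $ v (Suc i)
    = edge_sign (Suc i) * x $ v (Suc (Suc i)) + edge_sign i * x $ v i"
proof -
  have "(adjacency_matrix E \<sigma> *v x) $ v (Suc i)
      = (\<Sum>u\<in>UNIV. if u \<in> {v i, v (Suc (Suc i))} then of_int (\<sigma> {v (Suc i), u}) * x $ u else 0)"
    unfolding matrix_vector_mult_def adjacency_matrix_def
    by (auto simp: edge_Suc_iff intro!: sum.cong)
  also have "\<dots> = (\<Sum>u\<in>{v i, v (Suc (Suc i))}. of_int (\<sigma> {v (Suc i), u}) * x $ u)"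
    by (subst sum.inter_restrict[symmetric]) auto
  also have "\<dots> = edge_sign (Suc i) * x $ v (Suc (Suc i)) + edge_sign i * x $ v i"
    using v_neq_Suc_Suc[of i] by (simp add: edge_sign_def insert_commute)
  finally show ?thesis .
qed

definition eigenspace :: "real \<Rightarrow> (real ^ 'v) set" where
  "eigenspace l = {x. (l *\<^sub>R mat 1 - adjacency_matrix E \<sigma>) *v x = 0}"

lemma eigenspace_iff:
  "x \<in> eigenspace l \<longleftrightarrow>
    (\<forall>i. edge_sign (Suc i) * x $ v (Suc (Suc i)) = l * x $ v (Suc i) - edge_sign i * x $ v i)"
proof -
  have "(l *\<^sub>R mat 1 - adjacency_matrix E \<sigma>) *v x = l *\<^sub>R x - adjacency_matrix E \<sigma> *v x"
    by (rule shifted_matrix_mult)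
  then have "x \<in> eigenspace l \<longleftrightarrow> l *\<^sub>R x = adjacency_matrix E \<sigma> *v x"
    unfolding eigenspace_def mem_Collect_eq by (metis right_minus_eq)
  also have "\<dots> \<longleftrightarrow> (\<forall>w. l * x $ w = (adjacency_matrix E \<sigma> *v x) $ w)"
    unfolding vec_eq_iff by (metis vector_scaleR_component real_scaleR_def)
  also have "\<dots> \<longleftrightarrow> (\<forall>i. l * x $ v (Suc i) = (adjacency_matrix E \<sigma> *v x) $ v (Suc i))"
  proof
    assume *: "\<forall>i. l * x $ v (Suc i) = (adjacency_matrix E \<sigma> *v x) $ v (Suc i)"
    show "\<forall>w. l * x $ w = (adjacency_matrix E \<sigma> *v x) $ w"
    proof
      fix w
      obtain i where "w = v (Suc i)" by (rule obtain_Suc)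
      with * show "l * x $ w = (adjacency_matrix E \<sigma> *v x) $ w" by blast
    qed
  qed blast
  finally show ?thesis unfolding adjacency_mult_Suc by (auto simp: algebra_simps)
qed

text \<open>Multiplication by \<open>switch\<close> removes the signs from the eigenvector equation,
  because each edge sign squares to 1. The second starting value carries the factor
  \<open>switch 1\<close>, that is, \<open>edge_sign 0\<close>.\<close>

lemma eigenspace_rec2:
  assumes "x \<in> eigenspace l"
  shows "switch i * x $ v i = rec2 l (x $ v 0) (edge_sign 0 * x $ v 1) i"
proof -
  have "switch (Suc (Suc i)) * x $ v (Suc (Suc i))
      = l * (switch (Suc i) * x $ v (Suc i)) - switch i * x $ v i" for i
  proof -
    have "switch (Suc (Suc i)) * x $ v (Suc (Suc i))
        = switch (Suc i) * (edge_sign (Suc i) * x $ v (Suc (Suc i)))"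
      by (simp add: switch_Suc)
    also have "\<dots> = switch (Suc i) * (l * x $ v (Suc i) - edge_sign i * x $ v i)"
      using assms by (simp add: eigenspace_iff)
    also have "switch (Suc i) * edge_sign i = switch i"
      using edge_sign_square[of i] by (simp add: switch_Suc)
    then have "switch (Suc i) * (l * x $ v (Suc i) - edge_sign i * x $ v i)
        = l * (switch (Suc i) * x $ v (Suc i)) - switch i * x $ v i"
      by (simp add: algebra_simps)
    finally show ?thesis .
  qed
  from rec2_unique[of "\<lambda>i. switch i * x $ v i", OF this] show ?thesis
    by (simp add: switch_def)
qed

text \<open>An eigenvector is a function of the vertex, hence periodic in the index, and
  \<open>switch\<close> contributes the factor \<open>switch n\<close>. Conversely,
  \<open>switch\<close> is its own inverse and turns a quasi-periodic solution into a periodic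
  sequence, which descends to the vertices.\<close>

lemma eigenspace_surj_iff:
  "(\<forall>a b. \<exists>x\<in>eigenspace l. x $ v 0 = a \<and> x $ v 1 = b) \<longleftrightarrow>
   (\<forall>a b i. rec2 l a b (i + n) = switch n * rec2 l a b i)"
proof (intro iffI allI)
  fix a b i
  assume "\<forall>a b. \<exists>x\<in>eigenspace l. x $ v 0 = a \<and> x $ v 1 = b"
  \<comment> \<open>The factor \<open>edge_sign 0\<close> is chosen to cancel in
    \<open>eigenspace_rec2\<close>, leaving the starting value \<open>b\<close>.\<close>
  then obtain x where x: "x \<in> eigenspace l" "x $ v 0 = a" "x $ v 1 = edge_sign 0 * b" by blast
  have r: "switch i * x $ v i = rec2 l a b i" for i
    using eigenspace_rec2[OF x(1), of i] by (simp only: x edge_sign_cancel)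
  show "rec2 l a b (i + n) = switch n * rec2 l a b i"
    unfolding r[symmetric] by (simp add: switch_add v_add)
next
  fix a b
  assume *: "\<forall>a b i. rec2 l a b (i + n) = switch n * rec2 l a b i"
  define R where "R = rec2 l a (edge_sign 0 * b)"
  define f where "f i = switch i * R i" for i
  have f_add: "f (i + n) = f i" for i
  proof -
    have "f (i + n) = (switch n * switch n) * (switch i * R i)"
      using * by (simp add: f_def switch_add R_def ac_simps)
    then show ?thesis by (simp add: switch_square f_def)
  qed
  have f_mult: "f (i + m * n) = f i" for i m
  proof (induction m)
    case (Suc m)
    then show ?case using f_add[of "i + m * n"] by (simp add: ac_simps)
  qed simp
  have f_mod: "f (i mod n) = f i" for i
    using f_mult[of "i mod n" "i div n"] by (simp add: add.commute)
  \<comment> \<open>The choice of index is harmless: \<open>f\<close> depends only on the index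
    modulo \<open>n\<close>, and so does the vertex.\<close>
  define x :: "real ^ 'v" where "x = (\<chi> w. f (SOME i. v i = w))"
  have xv: "x $ v i = f i" for i
  proof -
    have "v (SOME j. v j = v i) = v i" by (rule someI) simp
    then have "(SOME j. v j = v i) mod n = i mod n" by (simp add: v_eq_iff)
    then show ?thesis unfolding x_def using f_mod by (metis vec_lambda_beta)
  qed
  have "x \<in> eigenspace l"
    unfolding eigenspace_iff xv
  proof
    fix i
    have "edge_sign (Suc i) * f (Suc (Suc i))
        = (edge_sign (Suc i) * edge_sign (Suc i)) * switch (Suc i) * (l * R (Suc i) - R i)"
      by (simp add: f_def switch_Suc R_def)
    also have "\<dots> = l * f (Suc i) - switch (Suc i) * R i"
      by (simp add: edge_sign_square f_def algebra_simps)
    finally show "edge_sign (Suc i) * f (Suc (Suc i)) = l * f (Suc i) - edge_sign i * f i"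
      by (simp add: f_def switch_Suc)
  qed
  moreover have "x $ v 0 = a" by (simp add: xv f_def switch_def R_def)
  moreover have "x $ v 1 = b"
    by (simp add: xv f_def switch_def R_def edge_sign_cancel)
  ultimately show "\<exists>x\<in>eigenspace l. x $ v 0 = a \<and> x $ v 1 = b" by blast
qed

text \<open>Evaluation at \<open>v 0\<close> and \<open>v 1\<close> is linear into the plane, and
  injective on the eigenspace since the recurrence determines all other entries. The dimension is
  therefore 2 exactly when the image is the whole plane.\<close>

lemma dim_eigenspace_eq_2_iff:
  "dim (eigenspace l) = 2 \<longleftrightarrow> (\<forall>a b. \<exists>x\<in>eigenspace l. x $ v 0 = a \<and> x $ v 1 = b)"
proof -
  define L :: "real ^ 'v \<Rightarrow> real \<times> real" where "L x = (x $ v 0, x $ v 1)" for x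
  have lin: "linear L"
    by (rule linearI) (auto simp: L_def)
  have sub: "subspace (eigenspace l)"
    unfolding eigenspace_def by (intro linear_subspace_kernel matrix_vector_mul_linear)
  have "inj_on L (eigenspace l)"
  proof
    fix x y assume xy: "x \<in> eigenspace l" "y \<in> eigenspace l" "L x = L y"
    have "x $ w = y $ w" for w
    proof -
      obtain i where i: "w = v i" using v_surj by blast
      have "switch i * x $ v i = switch i * y $ v i"
        using eigenspace_rec2[OF xy(1), of i] eigenspace_rec2[OF xy(2), of i] xy(3) by (simp add: L_def)
      then show ?thesis using switch_square[of i] i by auto
    qed
    then show "x = y" by (simp add: vec_eq_iff)
  qed
  then have "dim (L ` eigenspace l) = dim (eigenspace l)"
    using sub by (intro dim_image_eq[OF lin]) (simp add: span_eq_iff[THEN iffD2])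
  then have "dim (eigenspace l) = 2 \<longleftrightarrow> span (L ` eigenspace l) = UNIV"
    using dim_eq_full[of "L ` eigenspace l"] by (simp add: numeral_2_eq_2)
  also have "\<dots> \<longleftrightarrow> L ` eigenspace l = UNIV"
    using linear_subspace_image[OF lin sub] by (simp add: span_eq_iff[THEN iffD2])
  also have "\<dots> \<longleftrightarrow> (\<forall>a b. \<exists>x\<in>eigenspace l. x $ v 0 = a \<and> x $ v 1 = b)"
  proof
    assume "L ` eigenspace l = UNIV"
    then have "(a, b) \<in> L ` eigenspace l" for a b by simp
    then show "\<forall>a b. \<exists>x\<in>eigenspace l. x $ v 0 = a \<and> x $ v 1 = b"
      by (auto simp: L_def image_iff eq_commute)
  next
    assume "\<forall>a b. \<exists>x\<in>eigenspace l. x $ v 0 = a \<and> x $ v 1 = b"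
    then have "(a, b) \<in> L ` eigenspace l" for a b
      unfolding L_def image_iff by (metis prod.inject)
    then show "L ` eigenspace l = UNIV" by auto
  qed
  finally show ?thesis .
qed

lemma eigenvalue_mult_eq_dim: "eigenvalue_mult E \<sigma> l = dim (eigenspace l)"
  using dim_kernel_matrix[of "l *\<^sub>R mat 1 - adjacency_matrix E \<sigma>"]
  by (simp add: eigenvalue_mult_def eigenspace_def)

lemma eigenvalue_mult_eq_2_iff:
  "eigenvalue_mult E \<sigma> l = 2 \<longleftrightarrow>
    (\<exists>k. 0 < k \<and> k < n \<and> l = 2 * cos (real k * pi / real n) \<and> (\<Prod>e\<in>E. \<sigma> e) = (- 1) ^ k)"
proof -
  have "of_int (\<Prod>e\<in>E. \<sigma> e) = ((- 1) ^ k :: real) \<longleftrightarrow> (\<Prod>e\<in>E. \<sigma> e) = (- 1) ^ k" for k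
    by (metis of_int_1 of_int_minus of_int_power of_int_eq_iff)
  then show ?thesis
    using rec2_fundamental_quasiperiodic_iff[of n l "switch n"] n3
    unfolding eigenvalue_mult_eq_dim dim_eigenspace_eq_2_iff eigenspace_surj_iff
      rec2_all_quasiperiodic_iff
    by (simp add: switch_n)
qed

lemma prod_signs: "(\<Prod>e\<in>E. \<sigma> e) = 1 \<or> (\<Prod>e\<in>E. \<sigma> e) = - 1"
proof -
  have "(\<Prod>e\<in>E. \<sigma> e) * (\<Prod>e\<in>E. \<sigma> e) = 1"
    using switch_square[of n] unfolding switch_n by (metis of_int_mult of_int_eq_1_iff)
  then show ?thesis by (simp add: zmult_eq_1_iff) 
qed

end

section \<open>From signed cycles to cyclic enumerations\<close>

lemma signed_cycle_enumeration:
  fixes E :: "'v::finite set set"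
  assumes "signed_cycle E \<sigma>"
  obtains v where "cycle_enumeration v E \<sigma> CARD('v)" and "girth E = CARD('v)"
proof -
  from assms obtain vs where sg: "signed_graph E \<sigma>" and cyc: "cycle_in E vs"
    and UN: "set vs = UNIV" and E: "E = closed_walk_edges vs"
    by (auto simp: signed_cycle_def)
  define n where "n = length vs"
  define v where "v i = vs ! (i mod n)" for i
  have n3: "3 \<le> n" and dist: "distinct vs" using cyc by (auto simp: cycle_in_def n_def)
  have n: "CARD('v) = n" using distinct_card[OF dist] UN by (simp add: n_def)
  interpret cycle_enumeration v E \<sigma> n
  proof
    show "3 \<le> n" by fact
    show "v i = v j \<longleftrightarrow> i mod n = j mod n" for i j
    proof -
      have "i mod n < length vs" "j mod n < length vs" using n3 by (simp_all flip: n_def)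
      then show ?thesis unfolding v_def by (rule nth_eq_iff_index_eq[OF dist])
    qed
    have "w \<in> range v" for w
    proof -
      have "w \<in> set vs" using UN by simp
      then obtain i where "i < n" "w = vs ! i" by (auto simp: in_set_conv_nth n_def)
      then have "w = v i" by (simp add: v_def)
      then show ?thesis by blast
    qed
    then show "range v = UNIV" by blast
    show "E = range (\<lambda>i. {v i, v (Suc i)})"
    proof
      show "E \<subseteq> range (\<lambda>i. {v i, v (Suc i)})"
      proof
        fix e assume "e \<in> E"
        then obtain i where "i < n" "e = {vs ! i, vs ! (Suc i mod n)}"
          unfolding E closed_walk_edges_def n_def by blast
        then have "e = {v i, v (Suc i)}" by (simp add: v_def)
        then show "e \<in> range (\<lambda>i. {v i, v (Suc i)})" by blast
      qed
      have "{v i, v (Suc i)} \<in> E" for i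
      proof -
        have "{v i, v (Suc i)} = {vs ! (i mod n), vs ! (Suc (i mod n) mod n)}"
          by (simp add: v_def mod_Suc_eq)
        moreover have "i mod n < length vs" using n3 unfolding n_def by (intro mod_less_divisor) linarith
        ultimately show ?thesis unfolding E closed_walk_edges_def n_def by blast
      qed
      then show "range (\<lambda>i. {v i, v (Suc i)}) \<subseteq> E" by blast
    qed
    show "\<sigma> e \<in> {1, -1}" if "e \<in> E" for e
      using sg that by (auto simp: signed_graph_def)
  qed
  show ?thesis
    using that[of v] cycle_enumeration_axioms girth_eq[OF cyc] n by simp
qed

section \<open>Index ranges and the final equivalence\<close>

text \<open>Put k = 2j: an integer j lies below the ceiling of n/2 iff j < n/2, that is, iff 2j <
  n.\<close>

lemma even_index_iff:
  "(\<exists>k. 0 < k \<and> k < n \<and> l = 2 * cos (real k * pi / real n) \<and> even k) \<longleftrightarrow>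
    (\<exists>j::int. j \<in> {1..\<lceil>real n / 2\<rceil> - 1} \<and> l = 2 * cos (2 * pi * of_int j / real n))"
proof
  assume "\<exists>k. 0 < k \<and> k < n \<and> l = 2 * cos (real k * pi / real n) \<and> even k"
  then obtain m where m: "0 < m" "2 * m < n" "l = 2 * cos (real (2 * m) * pi / real n)"
    by (auto elim!: evenE)
  have "of_int (int m) < real n / 2" using m(2) by simp
  then have "int m < \<lceil>real n / 2\<rceil>" unfolding less_ceiling_iff .
  then have "int m \<in> {1..\<lceil>real n / 2\<rceil> - 1}" using m(1) by simp
  moreover have "l = 2 * cos (2 * pi * of_int (int m) / real n)" using m(3) by (simp add: ac_simps)
  ultimately show "\<exists>j::int. j \<in> {1..\<lceil>real n / 2\<rceil> - 1} \<and> l = 2 * cos (2 * pi * of_int j / real n)"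
    by blast
next
  assume "\<exists>j::int. j \<in> {1..\<lceil>real n / 2\<rceil> - 1} \<and> l = 2 * cos (2 * pi * of_int j / real n)"
  then obtain j :: int where j: "1 \<le> j" "j < \<lceil>real n / 2\<rceil>" "l = 2 * cos (2 * pi * of_int j / real n)"
    by auto
  obtain m where m: "j = int m" using j(1) by (metis nonneg_int_cases order_trans zero_le_one)
  have "0 < 2 * m" "2 * m < n" using j m by (auto simp: less_ceiling_iff)
  moreover have "l = 2 * cos (real (2 * m) * pi / real n)" using j m by (simp add: ac_simps)
  ultimately show "\<exists>k. 0 < k \<and> k < n \<and> l = 2 * cos (real k * pi / real n) \<and> even k"
    by (intro exI[of _ "2 * m"]) simp
qed

text \<open>Put k = 2j + 1: an integer j lies below the ceiling of (n-1)/2 iff 2j + 1 < n.\<close>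

lemma odd_index_iff:
  "(\<exists>k. 0 < k \<and> k < n \<and> l = 2 * cos (real k * pi / real n) \<and> odd k) \<longleftrightarrow>
    (\<exists>j::int. j \<in> {0..\<lceil>(real n - 1) / 2\<rceil> - 1} \<and> l = 2 * cos ((2 * of_int j + 1) * pi / real n))"
proof
  assume "\<exists>k. 0 < k \<and> k < n \<and> l = 2 * cos (real k * pi / real n) \<and> odd k"
  then obtain m where m: "2 * m + 1 < n" "l = 2 * cos (real (2 * m + 1) * pi / real n)"
    by (auto elim!: oddE)
  have "of_int (int m) < (real n - 1) / 2" using m(1) by simp
  then have "int m < \<lceil>(real n - 1) / 2\<rceil>" unfolding less_ceiling_iff .
  then have "int m \<in> {0..\<lceil>(real n - 1) / 2\<rceil> - 1}" by simp
  moreover have "l = 2 * cos ((2 * of_int (int m) + 1) * pi / real n)" using m(2) by (simp add: ac_simps)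
  ultimately show "\<exists>j::int. j \<in> {0..\<lceil>(real n - 1) / 2\<rceil> - 1} \<and> l = 2 * cos ((2 * of_int j + 1) * pi / real n)"
    by blast
next
  assume "\<exists>j::int. j \<in> {0..\<lceil>(real n - 1) / 2\<rceil> - 1} \<and> l = 2 * cos ((2 * of_int j + 1) * pi / real n)"
  then obtain j :: int where j: "0 \<le> j" "j < \<lceil>(real n - 1) / 2\<rceil>" "l = 2 * cos ((2 * of_int j + 1) * pi / real n)"
    by auto
  obtain m where m: "j = int m" using j(1) by (metis nonneg_int_cases)
  have "0 < 2 * m + 1" "2 * m + 1 < n" using j m by (auto simp: less_ceiling_iff)
  moreover have "l = 2 * cos (real (2 * m + 1) * pi / real n)" using j m by (simp add: ac_simps)
  ultimately show "\<exists>k. 0 < k \<and> k < n \<and> l = 2 * cos (real k * pi / real n) \<and> odd k"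
    by (intro exI[of _ "2 * m + 1"]) simp
qed

theorem theorem5:
  fixes E :: "'v::finite set set" and \<sigma> :: "'v set \<Rightarrow> int" and lam :: real
  assumes "CARD('v) \<ge> 3"
    and "signed_cycle E \<sigma>"
  shows "int (eigenvalue_mult E \<sigma> lam) = int CARD('v) - int (girth E) + 2 \<longleftrightarrow>
    (balanced_cycle E \<sigma> \<and>
      (\<exists>j::int. j \<in> {1..\<lceil>real (girth E) / 2\<rceil> - 1} \<and>
        lam = 2 * cos (2 * pi * of_int j / real (girth E)))) \<or>
    (unbalanced_cycle E \<sigma> \<and>
      (\<exists>j::int. j \<in> {0..\<lceil>(real (girth E) - 1) / 2\<rceil> - 1} \<and>
        lam = 2 * cos ((2 * of_int j + 1) * pi / real (girth E))))"
proof -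
  define n where "n = CARD('v)"
  obtain v where enum: "cycle_enumeration v E \<sigma> n" and g: "girth E = n"
    using signed_cycle_enumeration[OF assms(2)] unfolding n_def by metis
  interpret cycle_enumeration v E \<sigma> n by (fact enum)
  let ?k = "\<lambda>k. 0 < k \<and> k < n \<and> lam = 2 * cos (real k * pi / real n)"
  have "int (eigenvalue_mult E \<sigma> lam) = int CARD('v) - int (girth E) + 2 \<longleftrightarrow>
      eigenvalue_mult E \<sigma> lam = 2"
    unfolding g n_def by simp
  also have "\<dots> \<longleftrightarrow> ((\<Prod>e\<in>E. \<sigma> e) = 1 \<and> (\<exists>k. ?k k \<and> even k)) \<or>
      ((\<Prod>e\<in>E. \<sigma> e) \<noteq> 1 \<and> (\<exists>k. ?k k \<and> odd k))"
  proof (cases "(\<Prod>e\<in>E. \<sigma> e) = 1")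
    case True
    then have "(\<Prod>e\<in>E. \<sigma> e) = (- 1) ^ k \<longleftrightarrow> even k" for k by (cases "even k") auto
    then show ?thesis using True unfolding eigenvalue_mult_eq_2_iff by auto
  next
    case False
    \<comment> \<open>Unbalanced only says that the product differs from 1; the parity argument
      needs the value -1.\<close>
    then have "(\<Prod>e\<in>E. \<sigma> e) = - 1" using prod_signs by blast
    then have "(\<Prod>e\<in>E. \<sigma> e) = (- 1) ^ k \<longleftrightarrow> odd k" for k by (cases "even k") auto
    then show ?thesis using False unfolding eigenvalue_mult_eq_2_iff by auto
  qed
  finally show ?thesis
    using even_index_iff[of n lam] odd_index_iff[of n lam] assms(2)
    unfolding balanced_cycle_def unbalanced_cycle_def g by simp
qed

end
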